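(* Let $\mathbb{H}$ be a separable, infinite-dimensional complex Hilbert space, let $n > 1$ be an integer, and let $\Phi = \{\phi_k\}_{k \ge 0}$ be a sequence in $\mathbb{H}$ such that: (a) the sequence $\Phi' = \{\phi_k\}_{k \ge n}$ is exact in $\mathbb{H}$; and (b) $\Phi$ has a reproducing partner $\Psi = \{\psi_k\}_{k \ge 0} \subseteq \mathbb{H}$. Then $\Phi'$ is a Schauder basis for $\mathbb{H}$.
   Context: Inner products are linear in the first variable. A sequence is complete if its finite linear span is dense in $\mathbb{H}$; it is minimal if no element lies in the closed linear span of the other elements; it is exact if it is both complete and minimal. A sequence $\{f_k\}_{k\ge n}$ is a Schauder basis for $\mathbb{H}$ if for each $f \in \mathbb{H}$ there exist unique scalars $c_k$ such that $f = \sum_{k=n}^\infty c_k f_k$, with convergence of the partial sums in norm in the given (natural) ordering. Two sequences $\Psi=\{\psi_k\}_{k\ge 0}$, $\Phi=\{\phi_k\}_{k\ge 0}$ in $\mathbb{H}$ form a reproducing pair $(\Psi,\Phi)$, and $\Psi$ is called a reproducing partner for $\Phi$, if for all $f,g\in\mathbb{H}$ the series $\sum_{k=0}^\infty \langle f,\psi_k\rangle\langle\phi_k,g\rangle$ converges (possibly conditionally, partial sums taken in the natural ordering) and the operator $S_{\Psi,\Phi}:\mathbb{H}\to\mathbb{H}$ weakly defined by $\langle S_{\Psi,\Phi}f,g\rangle=\sum_{k=0}^\infty \langle f,\psi_k\rangle\langle\phi_k,g\rangle$ is bounded and boundedly invertible. *)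

theory Defs
  imports "HOL-Analysis.Analysis"
begin

text \<open>
  Complex inner product spaces, with the inner product linear in the first variable.
  Norm, metric and topology are those of the underlying real normed space; the axiom
  \<open>cinner_self\<close> says that the norm is the one induced by the inner product (and so gives
  positive definiteness).
\<close>

class complex_inner_space = real_normed_vector +
  fixes scaleC :: "complex \<Rightarrow> 'a \<Rightarrow> 'a"  (infixr "*\<^sub>C" 75)
    and cinner :: "'a \<Rightarrow> 'a \<Rightarrow> complex"
  assumes scaleC_add_right: "a *\<^sub>C (x + y) = a *\<^sub>C x + a *\<^sub>C y"
    and scaleC_add_left: "(a + b) *\<^sub>C x = a *\<^sub>C x + b *\<^sub>C x"
    and scaleC_scaleC: "a *\<^sub>C (b *\<^sub>C x) = (a * b) *\<^sub>C x"
    and scaleC_one: "1 *\<^sub>C x = x"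
    and scaleC_of_real: "complex_of_real r *\<^sub>C x = r *\<^sub>R x"
    and cinner_add_left: "cinner (x + y) z = cinner x z + cinner y z"
    and cinner_scaleC_left: "cinner (a *\<^sub>C x) y = a * cinner x y"
    and cinner_commute: "cinner y x = cnj (cinner x y)"
    and cinner_self: "cinner x x = complex_of_real ((norm x)\<^sup>2)"

class complex_hilbert_space = complex_inner_space + complete_space

global_interpretation complex_vector:
  vector_space "scaleC :: complex \<Rightarrow> 'a \<Rightarrow> 'a::complex_inner_space"
  defines cspan = complex_vector.span
  by standard (simp_all add: scaleC_add_right scaleC_add_left scaleC_scaleC scaleC_one)

definition cinfinite_dimensional :: "'a::complex_inner_space itself \<Rightarrow> bool" where
  "cinfinite_dimensional _ \<longleftrightarrow> (\<nexists>B :: 'a set. finite B \<and> cspan B = UNIV)"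

text \<open>
  In the following, a sequence \<open>{f\<^sub>k}\<close> with \<open>k \<ge> n\<close> is given by the starting index \<open>n\<close> and a
  function \<open>f\<close> on all natural numbers, whose values below \<open>n\<close> are irrelevant.
\<close>

definition complete_seq :: "nat \<Rightarrow> (nat \<Rightarrow> 'a::complex_inner_space) \<Rightarrow> bool" where
  "complete_seq n f \<longleftrightarrow> closure (cspan (f ` {n..})) = UNIV"

definition minimal_seq :: "nat \<Rightarrow> (nat \<Rightarrow> 'a::complex_inner_space) \<Rightarrow> bool" where
  "minimal_seq n f \<longleftrightarrow> (\<forall>k\<ge>n. f k \<notin> closure (cspan (f ` ({n..} - {k}))))"

definition exact_seq :: "nat \<Rightarrow> (nat \<Rightarrow> 'a::complex_inner_space) \<Rightarrow> bool" where
  "exact_seq n f \<longleftrightarrow> complete_seq n f \<and> minimal_seq n f"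

text \<open>
  Extensionality of the coefficient function fixes its irrelevant values below \<open>n\<close>, so that
  uniqueness refers to the coefficients \<open>c\<^sub>k\<close> with \<open>k \<ge> n\<close> only.
\<close>

definition schauder_basis :: "nat \<Rightarrow> (nat \<Rightarrow> 'a::complex_inner_space) \<Rightarrow> bool" where
  "schauder_basis n f \<longleftrightarrow>
     (\<forall>x. \<exists>!c. c \<in> extensional {n..} \<and> (\<lambda>N. \<Sum>k=n..N. c k *\<^sub>C f k) \<longlonglongrightarrow> x)"

definition bounded_clinear :: "('a::complex_inner_space \<Rightarrow> 'b::complex_inner_space) \<Rightarrow> bool" where
  "bounded_clinear T \<longleftrightarrow> bounded_linear T \<and> (\<forall>a x. T (a *\<^sub>C x) = a *\<^sub>C T x)"

definition boundedly_invertible :: "('a::complex_inner_space \<Rightarrow> 'b::complex_inner_space) \<Rightarrow> bool" where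
  "boundedly_invertible T \<longleftrightarrow> bij T \<and> bounded_clinear (inv T)"

text \<open>
  The operator \<open>S\<close> below is determined by the \<open>sums\<close> condition, which also expresses the
  convergence of all the series (ordered partial sums).
\<close>

definition reproducing_pair ::
    "(nat \<Rightarrow> 'a::complex_inner_space) \<Rightarrow> (nat \<Rightarrow> 'a) \<Rightarrow> bool" where
  "reproducing_pair \<Psi> \<Phi> \<longleftrightarrow>
     (\<exists>S. (\<forall>f g. (\<lambda>k. cinner f (\<Psi> k) * cinner (\<Phi> k) g) sums cinner (S f) g) \<and>
          bounded_clinear S \<and> boundedly_invertible S)"

end

theory Submission
  imports Defs
begin

text \<open>
  Composing with the inverse of \<open>S\<close> gives bounded functionals \<open>a\<^sub>k\<close> such that every \<open>f\<close> is the
  weak sum of \<open>a\<^sub>k(f) \<phi>\<^sub>k\<close> over \<open>k \<ge> 0\<close>, so these partial sums are norm bounded for each \<open>f\<close>.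
  Let \<open>g\<^sub>k\<close>, \<open>k \<ge> n\<close>, be the sequence biorthogonal to \<open>\<Phi>'\<close> and \<open>T\<^sub>N\<close> the partial sum operators
  of \<open>\<Sum> \<langle>f, g\<^sub>k\<rangle> \<phi>\<^sub>k\<close>. On the common kernel of \<open>a\<^sub>0, \<dots>, a\<^sub>n\<^sub>-\<^sub>1\<close>, testing the weak expansion
  against \<open>g\<^sub>j\<close> shows \<open>a\<^sub>j(f) = \<langle>f, g\<^sub>j\<rangle>\<close>, so that the vectors \<open>T\<^sub>N f\<close> are bounded there. They are
  also bounded for \<open>f\<close> in the dense span of \<open>\<Phi>'\<close>, and a dense subspace containing the kernel of
  finitely many bounded functionals is the whole space. By uniform boundedness the \<open>T\<^sub>N\<close> are
  equicontinuous, and their convergence on the span of \<open>\<Phi>'\<close> extends to the whole space.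
\<close>

text \<open>Makes \<open>uniform_boundedness\<close>, stated for \<open>banach\<close>, applicable
  to Hilbert spaces.\<close>

instance complex_hilbert_space \<subseteq> banach ..

section \<open>Elementary inner product rules, Cauchy-Schwarz and closures of subspaces\<close>

lemma cinner_add_right: "cinner x (y + z) = cinner x y + cinner x z"
  by (metis cinner_add_left cinner_commute complex_cnj_add)

lemma cinner_scaleC_right: "cinner x (a *\<^sub>C y) = cnj a * cinner x y"
  by (metis cinner_commute cinner_scaleC_left complex_cnj_mult)

lemma cinner_zero_left [simp]: "cinner 0 y = 0"
  using cinner_add_left[of 0 0 y] by simp

lemma cinner_zero_right [simp]: "cinner x 0 = 0"
  using cinner_add_right[of x 0 0] by simp

lemma cinner_diff_left: "cinner (x - y) z = cinner x z - cinner y z"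
  by (metis add_diff_cancel_right' cinner_add_left diff_add_cancel)

lemma cinner_diff_right: "cinner x (y - z) = cinner x y - cinner x z"
  by (metis add_diff_cancel_right' cinner_add_right diff_add_cancel)

lemma cinner_sum_left: "cinner (sum f A) z = (\<Sum>i\<in>A. cinner (f i) z)"
  by (induction A rule: infinite_finite_induct) (simp_all add: cinner_add_left)

text \<open>Pythagoras for the orthogonal projection of \<open>x\<close> onto the line through
  \<open>y\<close>. It yields both Cauchy-Schwarz and the orthogonality of the nearest-point
  residual.\<close>

lemma norm_diff_projection:
  fixes x y :: "'a::complex_inner_space"
  assumes "y \<noteq> 0"
  shows "(norm (x - (cinner x y / of_real ((norm y)\<^sup>2)) *\<^sub>C y))\<^sup>2
           = (norm x)\<^sup>2 - (cmod (cinner x y))\<^sup>2 / (norm y)\<^sup>2"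
proof -
  let ?N = "of_real ((norm y)\<^sup>2) :: complex"
  let ?c = "cinner x y / ?N"
  have N: "?N \<noteq> 0" "cinner y y = ?N" "cnj ?N = ?N" "cinner x x = of_real ((norm x)\<^sup>2)"
    using assms by (simp_all add: cinner_self)
  have c: "cinner y x = cnj (cinner x y)"
    by (rule cinner_commute)
  have "complex_of_real ((norm (x - ?c *\<^sub>C y))\<^sup>2) = cinner (x - ?c *\<^sub>C y) (x - ?c *\<^sub>C y)"
    by (simp add: cinner_self)
  also have "\<dots> = of_real ((norm x)\<^sup>2) - cinner x y * cnj (cinner x y) / ?N"
    using N(1) by (simp add: cinner_diff_left cinner_diff_right cinner_scaleC_left
        cinner_scaleC_right N c field_simps del: of_real_power)
  also have "\<dots> = of_real ((norm x)\<^sup>2 - (cmod (cinner x y))\<^sup>2 / (norm y)\<^sup>2)"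
    by (simp add: complex_norm_square[symmetric])
  finally show ?thesis
    using of_real_eq_iff by blast
qed

lemma cinner_Cauchy_Schwarz:
  fixes x y :: "'a::complex_inner_space"
  shows "cmod (cinner x y) \<le> norm x * norm y"
proof (cases "y = 0")
  case False
  have "0 \<le> (norm x)\<^sup>2 - (cmod (cinner x y))\<^sup>2 / (norm y)\<^sup>2"
    by (metis norm_diff_projection[OF False] zero_le_power2)
  then have "(cmod (cinner x y))\<^sup>2 \<le> (norm x * norm y)\<^sup>2"
    using False by (simp add: field_simps power_mult_distrib)
  then show ?thesis
    by (rule power2_le_imp_le) simp
qed simp

lemma bounded_linear_cinner_left: "bounded_linear (\<lambda>x :: 'a::complex_inner_space. cinner x y)"
proof (rule bounded_linear_intro)
  show "cinner (r *\<^sub>R x) y = r *\<^sub>R cinner x y" for r and x :: 'a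
    using cinner_scaleC_left[of "of_real r" x y]
    by (simp add: scaleC_of_real scaleR_conv_of_real)
qed (use cinner_Cauchy_Schwarz cinner_add_left in auto)

lemma norm_scaleC: "norm (a *\<^sub>C x) = cmod a * norm (x :: 'a::complex_inner_space)"
proof -
  have "complex_of_real ((norm (a *\<^sub>C x))\<^sup>2) = (a * cnj a) * of_real ((norm x)\<^sup>2)"
    by (simp only: cinner_self[symmetric] cinner_scaleC_left cinner_scaleC_right mult_ac)
  also have "\<dots> = of_real ((cmod a * norm x)\<^sup>2)"
    by (simp add: complex_norm_square[symmetric] power_mult_distrib)
  finally have "(norm (a *\<^sub>C x))\<^sup>2 = (cmod a * norm x)\<^sup>2"
    using of_real_eq_iff by blast
  then show ?thesis
    by (simp add: power2_eq_iff_nonneg)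
qed

lemma bounded_linear_scaleC_right:
  "bounded_linear (\<lambda>x :: 'a::complex_inner_space. a *\<^sub>C x)"
proof (rule bounded_linear_intro)
  show "a *\<^sub>C r *\<^sub>R x = r *\<^sub>R a *\<^sub>C x" for r and x :: 'a
    by (metis mult.commute scaleC_of_real scaleC_scaleC)
  show "norm (a *\<^sub>C x) \<le> norm x * cmod a" for x :: 'a
    by (simp add: norm_scaleC)
qed (rule scaleC_add_right)

lemma bounded_linear_scaleC_left:
  "bounded_linear (\<lambda>a. a *\<^sub>C (x :: 'a::complex_inner_space))"
proof (rule bounded_linear_intro)
  show "(r *\<^sub>R a) *\<^sub>C x = r *\<^sub>R a *\<^sub>C x" for r a
    by (metis scaleC_of_real scaleC_scaleC scaleR_conv_of_real)
  show "norm (a *\<^sub>C x) \<le> norm a * norm x" for a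
    by (simp add: norm_scaleC)
qed (rule scaleC_add_left)

lemma csubspace_closure:
  fixes V :: "'a::complex_inner_space set"
  assumes "complex_vector.subspace V"
  shows "complex_vector.subspace (closure V)"
proof (rule complex_vector.subspaceI)
  show "0 \<in> closure V"
    using assms closure_subset complex_vector.subspace_0 by blast
next
  fix x y assume "x \<in> closure V" "y \<in> closure V"
  then obtain f g where "\<And>n. f n \<in> V" "f \<longlonglongrightarrow> x" "\<And>n. g n \<in> V" "g \<longlonglongrightarrow> y"
    by (auto simp: closure_sequential)
  then show "x + y \<in> closure V"
    unfolding closure_sequential
    by (intro exI[of _ "\<lambda>n. f n + g n"])
       (auto intro: tendsto_add complex_vector.subspace_add[OF assms])
next
  fix c x assume "x \<in> closure V"
  then obtain f where "\<And>n. f n \<in> V" "f \<longlonglongrightarrow> x"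
    by (auto simp: closure_sequential)
  then show "c *\<^sub>C x \<in> closure V"
    unfolding closure_sequential
    by (intro exI[of _ "\<lambda>n. c *\<^sub>C f n"])
       (auto intro: bounded_linear.tendsto[OF bounded_linear_scaleC_right]
         complex_vector.subspace_scale[OF assms])
qed

section \<open>Nearest points, orthogonal separation and biorthogonal sequences\<close>

lemma cinner_parallelogram:
  fixes x y :: "'a::complex_inner_space"
  shows "(norm (x + y))\<^sup>2 + (norm (x - y))\<^sup>2 = 2 * (norm x)\<^sup>2 + 2 * (norm y)\<^sup>2"
proof -
  have "complex_of_real ((norm (x + y))\<^sup>2 + (norm (x - y))\<^sup>2)
          = cinner (x + y) (x + y) + cinner (x - y) (x - y)"
    by (simp add: cinner_self)
  also have "\<dots> = 2 * cinner x x + 2 * cinner y y"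
    by (simp add: cinner_add_left cinner_add_right cinner_diff_left cinner_diff_right)
  also have "\<dots> = of_real (2 * (norm x)\<^sup>2 + 2 * (norm y)\<^sup>2)"
    by (simp add: cinner_self)
  finally show ?thesis
    using of_real_eq_iff by blast
qed

text \<open>A minimizing sequence is Cauchy by the parallelogram law, since midpoints stay in the
  convex set \<open>M\<close>; its limit lies in \<open>M\<close> by completeness and
  closedness.\<close>

lemma exists_nearest_point:
  fixes M :: "'a::complex_hilbert_space set"
  assumes M: "closed M" "convex M" "M \<noteq> {}"
  obtains p where "p \<in> M" "\<And>m. m \<in> M \<Longrightarrow> norm (x - p) \<le> norm (x - m)"
proof -
  define d where "d = infdist x M"
  have d0: "d \<ge> 0"
    by (simp add: d_def infdist_nonneg)
  have d_le: "d \<le> norm (x - m)" if "m \<in> M" for m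
    using infdist_le[OF that, of x] by (simp add: d_def dist_norm)
  have "\<exists>m\<in>M. norm (x - m) < d + 1 / real (Suc k)" for k
  proof (rule ccontr)
    assume "\<not> ?thesis"
    then have "d + 1 / real (Suc k) \<le> infdist x M"
      unfolding infdist_notempty[OF M(3)]
      by (intro cINF_greatest[OF M(3)]) (auto simp: dist_norm not_less)
    then show False
      by (simp add: d_def)
  qed
  then obtain u where u: "\<And>k. u k \<in> M" "\<And>k. norm (x - u k) < d + 1 / real (Suc k)"
    by metis
  have lim: "(\<lambda>k. d + 1 / real (Suc k)) \<longlonglongrightarrow> d"
    by real_asymp
  have close: "(norm (u k - u l))\<^sup>2
      \<le> 2 * (d + 1 / real (Suc k))\<^sup>2 + 2 * (d + 1 / real (Suc l))\<^sup>2 - 4 * d\<^sup>2" for k l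
  proof -
    \<comment> \<open>The midpoint is at distance at least \<open>d\<close> from \<open>x\<close>,
      which bounds the sum term of the parallelogram law below by
      \<open>4 * d\<^sup>2\<close>.\<close>
    have "(1/2) *\<^sub>R u k + (1/2) *\<^sub>R u l \<in> M"
      using u(1) by (intro convexD[OF M(2)]) auto
    then have "d \<le> norm (x - ((1/2) *\<^sub>R u k + (1/2) *\<^sub>R u l))"
      by (rule d_le)
    moreover have "(x - u k) + (x - u l) = 2 *\<^sub>R (x - ((1/2) *\<^sub>R u k + (1/2) *\<^sub>R u l))"
      by (simp add: algebra_simps scaleR_2)
    ultimately have "2 * d \<le> norm ((x - u k) + (x - u l))"
      by simp
    then have "4 * d\<^sup>2 \<le> (norm ((x - u k) + (x - u l)))\<^sup>2"
      using power_mono[of "2 * d" _ 2] d0 by (simp add: power_mult_distrib)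
    moreover have "(norm (x - u j))\<^sup>2 \<le> (d + 1 / real (Suc j))\<^sup>2" for j
      using u(2)[of j] by (intro power_mono) auto
    moreover have "norm ((x - u k) - (x - u l)) = norm (u k - u l)"
      by (simp add: norm_minus_commute)
    ultimately show ?thesis
      using cinner_parallelogram[of "x - u k" "x - u l"] by (smt (verit))
  qed
  have "Cauchy u"
  proof (rule metric_CauchyI)
    fix e :: real assume e: "e > 0"
    have "(\<lambda>k. 2 * ((d + 1 / real (Suc k))\<^sup>2 - d\<^sup>2)) \<longlonglongrightarrow> 2 * (d\<^sup>2 - d\<^sup>2)"
      by (intro tendsto_intros lim)
    then have "\<forall>\<^sub>F k in sequentially. 2 * ((d + 1 / real (Suc k))\<^sup>2 - d\<^sup>2) < e\<^sup>2 / 2"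
      using e by (intro order_tendstoD) auto
    then obtain K where K: "\<And>k. k \<ge> K \<Longrightarrow> 2 * ((d + 1 / real (Suc k))\<^sup>2 - d\<^sup>2) < e\<^sup>2 / 2"
      unfolding eventually_sequentially by blast
    have "dist (u k) (u l) < e" if "k \<ge> K" "l \<ge> K" for k l
    proof -
      have "(norm (u k - u l))\<^sup>2 < e\<^sup>2"
        using close[of k l] K[OF that(1)] K[OF that(2)] by (simp add: algebra_simps)
      then show ?thesis
        using e power2_less_imp_less[of "norm (u k - u l)" e] by (simp add: dist_norm)
    qed
    then show "\<exists>K. \<forall>k\<ge>K. \<forall>l\<ge>K. dist (u k) (u l) < e"
      by blast
  qed
  then obtain p where p: "u \<longlonglongrightarrow> p"
    using Cauchy_convergent_iff convergent_def by blast
  have "p \<in> M"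
    using M(1) u(1) p closed_sequentially by blast
  have "(\<lambda>k. norm (x - u k)) \<longlonglongrightarrow> norm (x - p)"
    by (intro tendsto_intros p)
  then have "norm (x - p) \<le> d"
    using u(2) by (intro LIMSEQ_le[OF _ lim]) (auto intro: less_imp_le)
  then show thesis
    using that[OF \<open>p \<in> M\<close>] d_le order_trans by blast
qed

text \<open>The residual of \<open>x\<close> at its nearest point in \<open>M\<close> is orthogonal
  to \<open>M\<close> and nonzero; \<open>g\<close> is a rescaling of it.\<close>

lemma exists_separating_orthogonal:
  fixes M :: "'a::complex_hilbert_space set"
  assumes M: "closed M" "complex_vector.subspace M" and x: "x \<notin> M"
  obtains g where "\<And>m. m \<in> M \<Longrightarrow> cinner m g = 0" "cinner x g = 1"
proof -
  have scale: "c *\<^sub>C m \<in> M" if "m \<in> M" for c m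
    using complex_vector.subspace_scale[OF M(2) that] .
  have add: "m + m' \<in> M" if "m \<in> M" "m' \<in> M" for m m'
    using complex_vector.subspace_add[OF M(2) that] .
  have "convex M"
    using scale add by (auto simp: convex_def simp flip: scaleC_of_real)
  moreover have "M \<noteq> {}"
    using complex_vector.subspace_0[OF M(2)] by blast
  ultimately obtain p where p: "p \<in> M" "\<And>m. m \<in> M \<Longrightarrow> norm (x - p) \<le> norm (x - m)"
    using exists_nearest_point[OF M(1)] by blast
  define z where "z = x - p"
  have z0: "z \<noteq> 0"
    using p(1) x by (auto simp: z_def)
  have orth: "cinner z m = 0" if m: "m \<in> M" for m
  proof (cases "m = 0")
    case False
    let ?c = "cinner z m / of_real ((norm m)\<^sup>2)"
    \<comment> \<open>The point \<open>p + ?c *\<^sub>C m\<close> is again in \<open>M\<close>, so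
      it is no closer to \<open>x\<close> than \<open>p\<close>; but subtracting a nonzero
      projection would shorten \<open>z\<close>.\<close>
    have "norm z \<le> norm (z - ?c *\<^sub>C m)"
      using p(2)[OF add[OF p(1) scale[OF m]], of ?c] by (simp add: z_def algebra_simps)
    then have "(norm z)\<^sup>2 \<le> (norm (z - ?c *\<^sub>C m))\<^sup>2"
      by (simp add: power_mono)
    then have "(cmod (cinner z m))\<^sup>2 / (norm m)\<^sup>2 \<le> 0"
      unfolding norm_diff_projection[OF False] by simp
    then show ?thesis
      using False by (simp add: divide_le_0_iff)
  qed simp
  have orth': "cinner m z = 0" if "m \<in> M" for m
    using orth[OF that] cinner_commute[of m z] by simp
  have "cinner x z = of_real ((norm z)\<^sup>2)"
    using orth'[OF p(1)] cinner_add_left[of z p z] by (simp add: cinner_self z_def)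
  then have "cinner x ((1 / of_real ((norm z)\<^sup>2)) *\<^sub>C z) = 1"
    using z0 by (simp add: cinner_scaleC_right)
  moreover have "cinner m ((1 / of_real ((norm z)\<^sup>2)) *\<^sub>C z) = 0" if "m \<in> M" for m
    using orth'[OF that] by (simp add: cinner_scaleC_right)
  ultimately show thesis
    using that by blast
qed

text \<open>By minimality each \<open>f j\<close> can be separated from the closed span of the other
  elements, and the separating vector is \<open>g j\<close>.\<close>

lemma minimal_seq_biorthogonal:
  fixes f :: "nat \<Rightarrow> 'a::complex_hilbert_space"
  assumes "minimal_seq n f"
  obtains g where "\<And>k j. k \<ge> n \<Longrightarrow> j \<ge> n \<Longrightarrow> cinner (f k) (g j) = (if k = j then 1 else 0)"
proof -
  have "\<exists>g. \<forall>k\<ge>n. cinner (f k) g = (if k = j then 1 else 0)" if j: "j \<ge> n" for j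
  proof -
    let ?M = "closure (cspan (f ` ({n..} - {j})))"
    have "f j \<notin> ?M"
      using assms j by (auto simp: minimal_seq_def)
    moreover have "complex_vector.subspace ?M"
      by (intro csubspace_closure complex_vector.subspace_span)
    ultimately obtain g where g: "\<And>m. m \<in> ?M \<Longrightarrow> cinner m g = 0" "cinner (f j) g = 1"
      using exists_separating_orthogonal[OF closed_closure] by blast
    have "f k \<in> ?M" if "k \<ge> n" "k \<noteq> j" for k
      using that by (intro subsetD[OF closure_subset] complex_vector.span_base) auto
    then show ?thesis
      using g by (intro exI[of _ g]) auto
  qed
  then have "\<forall>j. \<exists>g. j \<ge> n \<longrightarrow> (\<forall>k\<ge>n. cinner (f k) g = (if k = j then 1 else 0))"
    by blast
  from choice[OF this] show thesis
    using that by blast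
qed

section \<open>Uniform boundedness and dense subspaces of finite codimension\<close>

text \<open>Baire category: the closed sets \<open>E m\<close> cover the space, so one of them
  contains a ball, and linearity carries the bound on that ball to all vectors.\<close>

lemma uniform_boundedness:
  fixes T :: "'i \<Rightarrow> 'a::banach \<Rightarrow> 'b::real_normed_vector"
  assumes lin: "\<And>i. bounded_linear (T i)" and bdd: "\<And>x. bounded (range (\<lambda>i. T i x))"
  obtains C where "C \<ge> 0" "\<And>i x. norm (T i x) \<le> C * norm x"
proof -
  define E where "E m = (\<Inter>i. {x. norm (T i x) \<le> real m})" for m :: nat
  have "closed (E m)" for m
    unfolding E_def
    by (intro closed_INT ballI closed_Collect_le continuous_intros
        linear_continuous_on[OF lin])
  moreover have "x \<in> (\<Union>m. E m)" for x
  proof -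
    obtain b where "\<And>i. norm (T i x) \<le> b"
      using bdd[of x] by (auto simp: bounded_iff)
    moreover obtain m where "b \<le> real m"
      using real_arch_simple by blast
    ultimately show ?thesis
      by (auto simp: E_def intro: order_trans)
  qed
  then have "(\<Union>m. E m) = UNIV"
    by blast
  ultimately obtain m where m: "interior (E m) \<noteq> {}"
    using Baire_category_alt[of "euclidean :: 'a topology" "range E"]
      completely_metrizable_space_euclidean by fastforce
  then obtain x0 e where e: "e > 0" "cball x0 e \<subseteq> E m"
    by (auto simp: mem_interior_cball)
  then have x0: "norm (T i x0) \<le> m" for i
    using subsetD[OF e(2), of x0] by (simp add: E_def)
  have "norm (T i x) \<le> (2 * m / e) * norm x" for i x
  proof (cases "x = 0")
    case True
    then show ?thesis
      by (simp add: linear_simps[OF lin])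
  next
    case False
    \<comment> \<open>Scaled to norm \<open>e\<close>, so that \<open>x0 + ?y\<close> stays in the
      ball. Subtracting \<open>T i x0\<close> costs a second \<open>m\<close>, hence the factor 2 in
      the constant.\<close>
    let ?y = "(e / norm x) *\<^sub>R x"
    have "x0 + ?y \<in> cball x0 e"
      using False e(1) by (simp add: dist_norm)
    then have "norm (T i (x0 + ?y)) \<le> m"
      using e(2) by (auto simp: E_def)
    then have "norm (T i ?y) \<le> 2 * m"
      using norm_triangle_ineq4[of "T i (x0 + ?y)" "T i x0"] x0[of i]
      by (simp add: linear_simps[OF lin])
    then show ?thesis
      using False e(1) by (simp add: linear_simps[OF lin] field_simps)
  qed
  then show thesis
    using that[of "2 * m / e"] e(1) by simp
qed

text \<open>Uniform boundedness for the functionals pairing with \<open>v i\<close>, whose common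
  bound is then tested at \<open>v i\<close> itself.\<close>

lemma weakly_bounded_imp_bounded:
  fixes v :: "'i \<Rightarrow> 'a::complex_hilbert_space"
  assumes "\<And>g. bounded (range (\<lambda>i. cinner (v i) g))"
  shows "bounded (range v)"
proof -
  have "cmod (cinner g (v i)) = cmod (cinner (v i) g)" for g i
    by (metis cinner_commute complex_mod_cnj)
  then have "bounded (range (\<lambda>i. cinner g (v i)))" for g
    using assms[of g] by (simp add: bounded_iff)
  then obtain C where C: "\<And>i g. cmod (cinner g (v i)) \<le> C * norm g"
    using uniform_boundedness[of "\<lambda>i g. cinner g (v i)"] bounded_linear_cinner_left by blast
  have "norm (v i) \<le> max C 0" for i
  proof (cases "v i = 0")
    case False
    then show ?thesis
      using C[of "v i" i] by (simp add: cinner_self norm_power power2_eq_square norm_mult)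
  qed simp
  then show ?thesis
    by (auto simp: bounded_iff)
qed

lemma dense_csubspace_finite_codim:
  fixes V :: "'a::complex_inner_space set" and a :: "nat \<Rightarrow> 'a \<Rightarrow> complex"
  assumes V: "complex_vector.subspace V" "closure V = UNIV"
    and "\<And>i. i < m \<Longrightarrow> bounded_linear (a i)"
    and "\<And>i c x. i < m \<Longrightarrow> a i (c *\<^sub>C x) = c * a i x"
    and "{x. \<forall>i<m. a i x = 0} \<subseteq> V"
  shows "V = UNIV"
  using assms(3-)
proof (induction m arbitrary: a)
  case 0
  then show ?case by auto
next
  case (Suc m)
  show ?case
  proof (cases "\<forall>v\<in>V. a m v = 0")
    case True
    have "closed {x. a m x = 0}"
      by (intro closed_Collect_eq continuous_intros linear_continuous_on Suc.prems) auto
    then have "closure V \<subseteq> {x. a m x = 0}"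
      using True by (intro closure_minimal) auto
    then have "a m x = 0" for x
      using V(2) by auto
    then have "{x. \<forall>i<m. a i x = 0} \<subseteq> V"
      using Suc.prems(3) by (auto simp: less_Suc_eq)
    then show ?thesis
      using Suc by (intro Suc.IH[of a]) auto
  next
    case False
    then obtain u where u: "u \<in> V" "a m u \<noteq> 0"
      by blast
    define v where "v = (1 / a m u) *\<^sub>C u"
    have v: "v \<in> V" "a m v = 1"
      using u Suc.prems(2)[of m] complex_vector.subspace_scale[OF V(1)]
      by (auto simp: v_def)
    \<comment> \<open>Composing with the projection along \<open>v\<close> onto the kernel of \<open>a m\<close> removes one functional.\<close>
    define b where "b i x = a i x - a m x * a i v" for i x
    have ax: "b i x = a i (x - a m x *\<^sub>C v)" if "i < Suc m" for i x
      using Suc.prems(1,2)[OF that] by (simp add: b_def linear_simps)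
    show ?thesis
    proof (rule Suc.IH[of b])
      fix i assume "i < m"
      then show "bounded_linear (b i)" and "b i (c *\<^sub>C x) = c * b i x" for c x
        unfolding b_def using Suc.prems(1,2)
        by (auto intro!: bounded_linear_sub bounded_linear_mult_const bounded_linear_const_mult
          simp: algebra_simps)
    next
      have "x \<in> V" if x: "\<forall>i<m. b i x = 0" for x
      proof -
        \<comment> \<open>Hence the projection of \<open>x\<close> is annihilated by all of
          \<open>a 0, ..., a m\<close> and lies in \<open>V\<close>; adding back a multiple of
          \<open>v\<close> stays in \<open>V\<close>.\<close>
        have "b m x = 0"
          by (simp add: b_def v)
        then have "x - a m x *\<^sub>C v \<in> V"
          using x ax Suc.prems(3) by (auto simp: less_Suc_eq)
        then show ?thesis
          using v(1) complex_vector.subspace_add[OF V(1)] complex_vector.subspace_scale[OF V(1)]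
          by (metis diff_add_cancel)
      qed
      then show "{x. \<forall>i<m. b i x = 0} \<subseteq> V"
        by blast
    qed
  qed
qed

theorem theorem5p3:
  fixes \<Phi> :: "nat \<Rightarrow> 'a::complex_hilbert_space" and n :: nat
  assumes "separable_space (euclidean :: 'a topology)"
    and "cinfinite_dimensional TYPE('a)"
    and "n > 1"
    and "exact_seq n \<Phi>"
    and "\<exists>\<Psi> :: nat \<Rightarrow> 'a. reproducing_pair \<Psi> \<Phi>"
  shows "schauder_basis n \<Phi>"
proof -

  \<comment> \<open>Weak expansions from the reproducing pair\<close>
  obtain \<Psi> :: "nat \<Rightarrow> 'a" and S where
    weak: "\<And>f h. (\<lambda>k. cinner f (\<Psi> k) * cinner (\<Phi> k) h) sums cinner (S f) h"
    and "boundedly_invertible S"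
    using assms(5) unfolding reproducing_pair_def by blast
  then have S: "S (inv S f) = f" "bounded_linear (inv S)" "inv S (c *\<^sub>C f) = c *\<^sub>C inv S f"
    for f c
    by (auto simp: boundedly_invertible_def bounded_clinear_def bij_is_surj surj_f_inv_f)
  define a where "a k f = cinner (inv S f) (\<Psi> k)" for k f
  have a_lin: "bounded_linear (a k)" for k
    unfolding a_def by (rule bounded_linear_compose[OF bounded_linear_cinner_left S(2)])
  have a_scale: "a k (c *\<^sub>C f) = c * a k f" for k c f
    by (simp add: a_def S(3) cinner_scaleC_left)
  have a_sums: "(\<lambda>k. a k f * cinner (\<Phi> k) h) sums cinner f h" for f h
    using weak[of "inv S f" h] by (simp add: a_def S(1))
  have bdd_weak_sums: "bounded (range (\<lambda>N. \<Sum>k<N. a k f *\<^sub>C \<Phi> k))" for f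
  proof (rule weakly_bounded_imp_bounded)
    fix h
    have "(\<lambda>N. cinner (\<Sum>k<N. a k f *\<^sub>C \<Phi> k) h) \<longlonglongrightarrow> cinner f h"
      using a_sums[of f h] by (simp add: sums_def cinner_sum_left cinner_scaleC_left)
    then show "bounded (range (\<lambda>N. cinner (\<Sum>k<N. a k f *\<^sub>C \<Phi> k) h))"
      by (rule convergent_imp_bounded)
  qed

  \<comment> \<open>The biorthogonal sequence and its partial sum operators\<close>
  have dense: "closure (cspan (\<Phi> ` {n..})) = UNIV" and "minimal_seq n \<Phi>"
    using assms(4) by (auto simp: exact_seq_def complete_seq_def)
  then obtain g where
    g: "\<And>k j. k \<ge> n \<Longrightarrow> j \<ge> n \<Longrightarrow> cinner (\<Phi> k) (g j) = (if k = j then 1 else 0)"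
    using minimal_seq_biorthogonal by blast
  define T where "T N f = (\<Sum>k=n..<N. cinner f (g k) *\<^sub>C \<Phi> k)" for N f
  have T_lin: "bounded_linear (T N)" for N
    unfolding T_def
    by (intro bounded_linear_sum bounded_linear_compose[OF bounded_linear_scaleC_left]
        bounded_linear_cinner_left)
  have T_scale: "T N (c *\<^sub>C f) = c *\<^sub>C T N f" for N c f
    by (simp add: T_def cinner_scaleC_left complex_vector.scale_sum_right scaleC_scaleC)
  have T_\<Phi>: "T N (\<Phi> j) = \<Phi> j" if "j \<ge> n" "N > j" for N j
  proof -
    have "T N (\<Phi> j) = (\<Sum>k=n..<N. if k = j then \<Phi> j else 0)"
      unfolding T_def using that g
      by (intro sum.cong) (auto simp: scaleC_one complex_vector.scale_zero_left)
    then show ?thesis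
      using that by simp
  qed
  then have T_\<Phi>_lim: "(\<lambda>N. T N (\<Phi> j)) \<longlonglongrightarrow> \<Phi> j" if "j \<ge> n" for j
    using that by (intro tendsto_eventually) (auto intro: eventually_sequentiallyI[of "Suc j"])

  \<comment> \<open>Boundedness of the partial sums at every vector\<close>
  define B where "B = {f. bounded (range (\<lambda>N. T N f))}"
  have B_sub: "complex_vector.subspace B"
  proof (rule complex_vector.subspaceI)
    show "0 \<in> B"
      by (auto simp: B_def linear_simps[OF T_lin] bounded_iff)
  next
    fix x y assume "x \<in> B" "y \<in> B"
    then show "x + y \<in> B"
      by (simp add: B_def linear_simps[OF T_lin] bounded_plus_comp)
  next
    fix c x assume "x \<in> B"
    then show "c *\<^sub>C x \<in> B"
      using bounded_linear_image[OF _ bounded_linear_scaleC_right, of "range (\<lambda>N. T N x)" c]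
      by (simp add: B_def T_scale image_image)
  qed
  have "cspan (\<Phi> ` {n..}) \<subseteq> B"
    using T_\<Phi>_lim
    by (intro complex_vector.span_minimal B_sub) (auto simp: B_def intro: convergent_imp_bounded)
  then have "closure B = UNIV"
    using dense closure_mono by blast
  moreover have "{f. \<forall>i<n. a i f = 0} \<subseteq> B"
  proof clarify
    fix f assume f: "\<forall>i<n. a i f = 0"
    have "a j f = cinner f (g j)" if "j \<ge> n" for j
    proof -
      \<comment> \<open>Terms with \<open>k < n\<close> vanish by the choice of \<open>f\<close>;
        among the others biorthogonality leaves only \<open>k = j\<close>.\<close>
      have "a k f * cinner (\<Phi> k) (g j) = (if k = j then a k f else 0)" for k
        using f g[of k j] that by (cases "k < n") auto
      then have "(\<lambda>k. a k f * cinner (\<Phi> k) (g j)) sums a j f"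
        using sums_single[of j "\<lambda>k. a k f"] by simp
      then show ?thesis
        using a_sums sums_unique2 by blast
    qed
    \<comment> \<open>The coefficients below \<open>n\<close> are zero, so starting the sum at 0
      instead of \<open>n\<close> changes nothing.\<close>
    then have "T N f = (\<Sum>k<N. a k f *\<^sub>C \<Phi> k)" for N
      unfolding T_def using f
      by (intro sum.mono_neutral_cong_left) (auto simp: complex_vector.scale_zero_left)
    then show "f \<in> B"
      using bdd_weak_sums by (simp add: B_def)
  qed
  ultimately have "B = UNIV"
    by (intro dense_csubspace_finite_codim[of B n a] a_lin a_scale B_sub)
  then have "bounded (range (\<lambda>N. T N f))" for f
    by (auto simp: B_def)
  then obtain C where C: "C \<ge> 0" "\<And>N f. norm (T N f) \<le> C * norm f"
    by (rule uniform_boundedness[of T, OF T_lin]) blast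

  \<comment> \<open>Convergence of the partial sums at every vector\<close>
  define L where "L = {f. (\<lambda>N. T N f) \<longlonglongrightarrow> f}"
  have "complex_vector.subspace L"
    by (rule complex_vector.subspaceI)
       (auto simp: L_def linear_simps[OF T_lin] T_scale
         intro: tendsto_add bounded_linear.tendsto[OF bounded_linear_scaleC_right])
  then have "cspan (\<Phi> ` {n..}) \<subseteq> L"
    using T_\<Phi>_lim by (intro complex_vector.span_minimal) (auto simp: L_def)
  have T_lim: "(\<lambda>N. T N f) \<longlonglongrightarrow> f" for f
  proof (rule metric_LIMSEQ_I)
    fix e :: real assume e: "e > 0"
    \<comment> \<open>Approximating \<open>f\<close> by \<open>h\<close> within \<open>d\<close>
      costs at most \<open>C * d\<close> through \<open>T N\<close> and \<open>d\<close> directly,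
      together \<open>e / 2\<close>; the other half is for the convergence at \<open>h\<close>.
      Adding 1 keeps the denominator positive when \<open>C = 0\<close>.\<close>
    define d where "d = e / (2 * (C + 1))"
    have d: "d > 0" "(C + 1) * d = e / 2"
      using e C(1) by (auto simp: d_def field_simps)
    have "f \<in> closure (cspan (\<Phi> ` {n..}))"
      using dense by simp
    then obtain h where "h \<in> cspan (\<Phi> ` {n..})" "dist h f < d"
      using d(1) closure_approachable by blast
    then have h: "(\<lambda>N. T N h) \<longlonglongrightarrow> h" "norm (f - h) < d"
      using \<open>cspan (\<Phi> ` {n..}) \<subseteq> L\<close> by (auto simp: L_def dist_norm norm_minus_commute)
    obtain N0 where N0: "\<And>N. N \<ge> N0 \<Longrightarrow> norm (T N h - h) < e / 2"
      using LIMSEQ_D[OF h(1), of "e / 2"] e by auto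
    have "dist (T N f) f < e" if "N \<ge> N0" for N
    proof -
      have "T N f - f = T N (f - h) + (T N h - h) - (f - h)"
        by (simp add: linear_simps[OF T_lin])
      then have "norm (T N f - f) \<le> norm (T N (f - h)) + norm (T N h - h) + norm (f - h)"
        using norm_triangle_ineq4[of "T N (f - h) + (T N h - h)" "f - h"]
          norm_triangle_ineq[of "T N (f - h)" "T N h - h"] by simp
      also have "\<dots> < (C + 1) * norm (f - h) + e / 2"
        using C(2)[of N "f - h"] N0[OF that] by (simp add: algebra_simps)
      also have "\<dots> \<le> (C + 1) * d + e / 2"
        using h(2) C(1) by (intro add_right_mono mult_left_mono) auto
      finally show ?thesis
        using d(2) by (simp add: dist_norm)
    qed
    then show "\<exists>N0. \<forall>N\<ge>N0. dist (T N f) f < e"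
      by blast
  qed

  \<comment> \<open>Existence and uniqueness of the coefficients\<close>
  show ?thesis
    unfolding schauder_basis_def
  proof (intro allI ex1I conjI)
    fix x
    let ?c = "restrict (\<lambda>k. cinner x (g k)) {n..}"
    show "?c \<in> extensional {n..}"
      by simp
    \<comment> \<open>The index shifts by one because \<open>T N\<close> stops before
      \<open>N\<close>, while the sums in \<open>schauder_basis\<close> include
      \<open>N\<close>.\<close>
    have "(\<Sum>k=n..N. ?c k *\<^sub>C \<Phi> k) = T (Suc N) x" for N
      by (simp add: T_def atLeastLessThanSuc_atLeastAtMost)
    then show "(\<lambda>N. \<Sum>k=n..N. ?c k *\<^sub>C \<Phi> k) \<longlonglongrightarrow> x"
      using LIMSEQ_Suc[OF T_lim[of x]] by simp
  next
    fix x c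
    assume c: "c \<in> extensional {n..} \<and> (\<lambda>N. \<Sum>k=n..N. c k *\<^sub>C \<Phi> k) \<longlonglongrightarrow> x"
    \<comment> \<open>Pairing with \<open>g j\<close> is continuous and reads off \<open>c j\<close>
      from every partial sum with \<open>N \<ge> j\<close>.\<close>
    have "c j = cinner x (g j)" if j: "j \<ge> n" for j
    proof -
      have "cinner (\<Sum>k=n..N. c k *\<^sub>C \<Phi> k) (g j) = c j" if "N \<ge> j" for N
      proof -
        have "cinner (\<Sum>k=n..N. c k *\<^sub>C \<Phi> k) (g j) = (\<Sum>k=n..N. if k = j then c j else 0)"
          unfolding cinner_sum_left
          using g j by (intro sum.cong) (auto simp: cinner_scaleC_left)
        then show ?thesis
          using j that by simp
      qed
      then have "(\<lambda>N. cinner (\<Sum>k=n..N. c k *\<^sub>C \<Phi> k) (g j)) \<longlonglongrightarrow> c j"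
        by (intro tendsto_eventually eventually_sequentiallyI)
      moreover have "(\<lambda>N. cinner (\<Sum>k=n..N. c k *\<^sub>C \<Phi> k) (g j)) \<longlonglongrightarrow> cinner x (g j)"
        using c by (intro bounded_linear.tendsto[OF bounded_linear_cinner_left]) simp
      ultimately show ?thesis
        using LIMSEQ_unique by blast
    qed
    then show "c = restrict (\<lambda>k. cinner x (g k)) {n..}"
      using c by (auto simp: extensional_def fun_eq_iff)
  qed
qed

end
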